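(* Let $(A,\searrow_1,\searrow_2,\nearrow_1,\nearrow_2,\nwarrow_1,\nwarrow_2,\swarrow_1,\swarrow_2)$ be an octo-algebra. For $x,y\in A$ put $$x\triangleright_1^2y=x\searrow_2y-y\nwarrow_1x,\quad x\triangleleft_1^2y=x\nearrow_2y-y\swarrow_1x,\quad x\triangleright_2^1y=x\searrow_1y-y\nwarrow_2x,\quad x\triangleleft_2^1y=x\nearrow_1y-y\swarrow_2x.$$ Then $(A,\triangleright_1^2,\triangleleft_1^2,\triangleleft_2^1,\triangleright_2^1)$ is an L-quadri-algebra (the four products playing the roles of $\searrow,\nearrow,\nwarrow,\swarrow$ in this order).
   Context: All algebras are finite-dimensional over a field of characteristic zero. For eight bilinear products $\searrow_i,\nearrow_i,\nwarrow_i,\swarrow_i$ ($i=1,2$) on a vector space $A$, put for $i=1,2$: $x\vee_iy=x\searrow_iy+x\swarrow_iy$, $x\wedge_iy=x\nearrow_iy+x\nwarrow_iy$, $x\succ_iy=x\searrow_iy+x\nearrow_iy$, $x\prec_iy=x\nwarrow_iy+x\swarrow_iy$, $x\ast_iy=x\searrow_iy+x\nearrow_iy+x\nwarrow_iy+x\swarrow_iy$; and for each symbol $\diamond\in\{\searrow,\nearrow,\nwarrow,\swarrow,\vee,\wedge,\succ,\prec,\ast\}$ put $x\diamond_{12}y=x\diamond_1y+x\diamond_2y$. Consider the 14 equations (for all $x,y,z\in A$): (A1) $x\searrow_2(y\searrow_2z)-(x\ast_{12}y)\searrow_2z=y\searrow_2(x\searrow_2z)-(y\ast_{12}x)\searrow_2z$;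 (A2) $x\searrow_2(y\nearrow_2z)-(x\vee_{12}y)\nearrow_2z=y\nearrow_2(x\succ_2z)-(y\wedge_{12}x)\nearrow_2z$; (A3) $x\searrow_2(y\nearrow_1z)-(x\vee_2y)\nearrow_1z=y\nearrow_1(x\succ_{12}z)-(y\wedge_1x)\nearrow_1z$; (A4) $x\nearrow_2(y\succ_1z)-(x\wedge_2y)\nearrow_1z=y\searrow_1(x\nearrow_{12}z)-(y\vee_1x)\nearrow_1z$; (A5) $x\searrow_2(y\searrow_1z)-(x\ast_2y)\searrow_1z=y\searrow_1(x\searrow_{12}z)-(y\ast_1x)\searrow_1z$; (A6) $x\searrow_2(y\nwarrow_1z)-(x\searrow_2y)\nwarrow_1z=y\nwarrow_1(x\ast_{12}z)-(y\nwarrow_1x)\nwarrow_1z$; (A7) $x\nearrow_2(y\prec_1z)-(x\nearrow_2y)\nwarrow_1z=y\swarrow_1(x\wedge_{12}z)-(y\swarrow_1x)\nwarrow_1z$; (A8) $x\nearrow_1(y\prec_{12}z)-(x\nearrow_1y)\nwarrow_1z=y\swarrow_2(x\wedge_1z)-(y\swarrow_2x)\nwarrow_1z$; (A9) $x\searrow_1(y\swarrow_{12}z)-(x\succ_1y)\swarrow_1z=y\swarrow_2(x\vee_1z)-(y\prec_2x)\swarrow_1z$; (A10) $x\searrow_1(y\nwarrow_{12}z)-(x\searrow_1y)\nwarrow_1z=y\nwarrow_2(x\ast_1z)-(y\nwarrow_2x)\nwarrow_1z$; (A11) $x\searrow_2(y\swarrow_1z)-(x\succ_2y)\swarrow_1z=y\swarrow_1(x\vee_{12}z)-(y\prec_1x)\swarrow_1z$;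 (A12) $x\searrow_2(y\swarrow_2z)-(x\succ_{12}y)\swarrow_2z=y\swarrow_2(x\vee_2z)-(y\prec_{12}x)\swarrow_2z$; (A13) $x\nearrow_2(y\prec_2z)-(x\nearrow_{12}y)\nwarrow_2z=y\swarrow_2(x\wedge_2z)-(y\swarrow_{12}x)\nwarrow_2z$; (A14) $x\searrow_2(y\nwarrow_2z)-(x\searrow_{12}y)\nwarrow_2z=y\nwarrow_2(x\ast_2z)-(y\nwarrow_{12}x)\nwarrow_2z$. An octo-algebra is such an $A$ for which both sides of each of (A1)–(A14) are zero for all $x,y,z\in A$. An L-quadri-algebra $(A,\searrow,\nearrow,\nwarrow,\swarrow)$ is a vector space with four bilinear products such that for all $x,y,z\in A$: $x\searrow(y\searrow z)-(x\ast y)\searrow z=y\searrow(x\searrow z)-(y\ast x)\searrow z$; $x\searrow(y\nearrow z)-(x\vee y)\nearrow z=y\nearrow(x\succ z)-(y\wedge x)\nearrow z$; $x\searrow(y\nwarrow z)-(x\searrow y)\nwarrow z=y\nwarrow(x\ast z)-(y\nwarrow x)\nwarrow z$; $x\nearrow(y\prec z)-(x\nearrow y)\nwarrow z=y\swarrow(x\wedge z)-(y\swarrow x)\nwarrow z$; $x\searrow(y\swarrow z)-(x\succ y)\swarrow z=y\swarrow(x\vee z)-(y\prec x)\swarrow z$; where $x\succ y=x\searrow y+x\nearrow y$, $x\prec y=x\nwarrow y+x\swarrow y$, $x\vee y=x\searrow y+x\swarrow y$, $x\wedge y=x\nearrow y+x\nwarrow y$, $x\ast y=x\searrow y+x\nearrow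 y+x\nwarrow y+x\swarrow y$. *)

theory Defs
  imports Complex_Main
begin

(* The dimension is asserted to be finite without fixing a basis. *)
locale fin_dim_space = vector_space scale
  for scale :: "'k::field_char_0 \<Rightarrow> 'a::ab_group_add \<Rightarrow> 'a" +
  assumes finite_dimensional: "\<exists>Basis. finite_dimensional_vector_space scale Basis"

definition bilinear_product ::
    "('k::field_char_0 \<Rightarrow> 'a::ab_group_add \<Rightarrow> 'a) \<Rightarrow> ('a \<Rightarrow> 'a \<Rightarrow> 'a) \<Rightarrow> bool"
  where "bilinear_product scale p \<longleftrightarrow>
    (\<forall>x. Vector_Spaces.linear scale scale (\<lambda>y. p x y)) \<and>
    (\<forall>y. Vector_Spaces.linear scale scale (\<lambda>x. p x y))"

locale four_products =
  fixes se :: "'a::ab_group_add \<Rightarrow> 'a \<Rightarrow> 'a" (infixl \<open>\<searrow>\<close> 70)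
  and ne :: "'a \<Rightarrow> 'a \<Rightarrow> 'a" (infixl \<open>\<nearrow>\<close> 70)
  and nw :: "'a \<Rightarrow> 'a \<Rightarrow> 'a" (infixl \<open>\<nwarrow>\<close> 70)
  and sw :: "'a \<Rightarrow> 'a \<Rightarrow> 'a" (infixl \<open>\<swarrow>\<close> 70)
begin

abbreviation vee :: "'a \<Rightarrow> 'a \<Rightarrow> 'a" (infixl \<open>\<^bold>\<or>\<close> 70)
  where "x \<^bold>\<or> y \<equiv> x \<searrow> y + x \<swarrow> y"

abbreviation wedge :: "'a \<Rightarrow> 'a \<Rightarrow> 'a" (infixl \<open>\<^bold>\<and>\<close> 70)
  where "x \<^bold>\<and> y \<equiv> x \<nearrow> y + x \<nwarrow> y"

abbreviation succ :: "'a \<Rightarrow> 'a \<Rightarrow> 'a" (infixl \<open>\<succ>\<close> 70)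
  where "x \<succ> y \<equiv> x \<searrow> y + x \<nearrow> y"

abbreviation prec :: "'a \<Rightarrow> 'a \<Rightarrow> 'a" (infixl \<open>\<prec>\<close> 70)
  where "x \<prec> y \<equiv> x \<nwarrow> y + x \<swarrow> y"

abbreviation ast :: "'a \<Rightarrow> 'a \<Rightarrow> 'a" (infixl \<open>\<ast>\<close> 70)
  where "x \<ast> y \<equiv> x \<searrow> y + x \<nearrow> y + x \<nwarrow> y + x \<swarrow> y"

end

locale L_quadri_algebra = fin_dim_space scale + four_products se ne nw sw
  for scale :: "'k::field_char_0 \<Rightarrow> 'a::ab_group_add \<Rightarrow> 'a"
  and se :: "'a \<Rightarrow> 'a \<Rightarrow> 'a" (infixl \<open>\<searrow>\<close> 70)
  and ne :: "'a \<Rightarrow> 'a \<Rightarrow> 'a" (infixl \<open>\<nearrow>\<close> 70)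
  and nw :: "'a \<Rightarrow> 'a \<Rightarrow> 'a" (infixl \<open>\<nwarrow>\<close> 70)
  and sw :: "'a \<Rightarrow> 'a \<Rightarrow> 'a" (infixl \<open>\<swarrow>\<close> 70) +
  assumes
    bilinear_se: "bilinear_product scale (\<searrow>)"
  and bilinear_ne: "bilinear_product scale (\<nearrow>)"
  and bilinear_nw: "bilinear_product scale (\<nwarrow>)"
  and bilinear_sw: "bilinear_product scale (\<swarrow>)"
  and L1: "x \<searrow> (y \<searrow> z) - (x \<ast> y) \<searrow> z =
    y \<searrow> (x \<searrow> z) - (y \<ast> x) \<searrow> z"
  and L2: "x \<searrow> (y \<nearrow> z) - (x \<^bold>\<or> y) \<nearrow> z =
    y \<nearrow> (x \<succ> z) - (y \<^bold>\<and> x) \<nearrow> z"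
  and L3: "x \<searrow> (y \<nwarrow> z) - (x \<searrow> y) \<nwarrow> z =
    y \<nwarrow> (x \<ast> z) - (y \<nwarrow> x) \<nwarrow> z"
  and L4: "x \<nearrow> (y \<prec> z) - (x \<nearrow> y) \<nwarrow> z =
    y \<swarrow> (x \<^bold>\<and> z) - (y \<swarrow> x) \<nwarrow> z"
  and L5: "x \<searrow> (y \<swarrow> z) - (x \<succ> y) \<swarrow> z =
    y \<swarrow> (x \<^bold>\<or> z) - (y \<prec> x) \<swarrow> z"

locale eight_products =
  fixes se1 :: "'a::ab_group_add \<Rightarrow> 'a \<Rightarrow> 'a" (infixl \<open>\<searrow>\<^sub>1\<close> 70)
  and se2 :: "'a \<Rightarrow> 'a \<Rightarrow> 'a" (infixl \<open>\<searrow>\<^sub>2\<close> 70)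
  and ne1 :: "'a \<Rightarrow> 'a \<Rightarrow> 'a" (infixl \<open>\<nearrow>\<^sub>1\<close> 70)
  and ne2 :: "'a \<Rightarrow> 'a \<Rightarrow> 'a" (infixl \<open>\<nearrow>\<^sub>2\<close> 70)
  and nw1 :: "'a \<Rightarrow> 'a \<Rightarrow> 'a" (infixl \<open>\<nwarrow>\<^sub>1\<close> 70)
  and nw2 :: "'a \<Rightarrow> 'a \<Rightarrow> 'a" (infixl \<open>\<nwarrow>\<^sub>2\<close> 70)
  and sw1 :: "'a \<Rightarrow> 'a \<Rightarrow> 'a" (infixl \<open>\<swarrow>\<^sub>1\<close> 70)
  and sw2 :: "'a \<Rightarrow> 'a \<Rightarrow> 'a" (infixl \<open>\<swarrow>\<^sub>2\<close> 70)
begin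

abbreviation vee1 :: "'a \<Rightarrow> 'a \<Rightarrow> 'a" (infixl \<open>\<^bold>\<or>\<^sub>1\<close> 70)
  where "x \<^bold>\<or>\<^sub>1 y \<equiv> x \<searrow>\<^sub>1 y + x \<swarrow>\<^sub>1 y"

abbreviation wedge1 :: "'a \<Rightarrow> 'a \<Rightarrow> 'a" (infixl \<open>\<^bold>\<and>\<^sub>1\<close> 70)
  where "x \<^bold>\<and>\<^sub>1 y \<equiv> x \<nearrow>\<^sub>1 y + x \<nwarrow>\<^sub>1 y"

abbreviation succ1 :: "'a \<Rightarrow> 'a \<Rightarrow> 'a" (infixl \<open>\<succ>\<^sub>1\<close> 70)
  where "x \<succ>\<^sub>1 y \<equiv> x \<searrow>\<^sub>1 y + x \<nearrow>\<^sub>1 y"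

abbreviation prec1 :: "'a \<Rightarrow> 'a \<Rightarrow> 'a" (infixl \<open>\<prec>\<^sub>1\<close> 70)
  where "x \<prec>\<^sub>1 y \<equiv> x \<nwarrow>\<^sub>1 y + x \<swarrow>\<^sub>1 y"

abbreviation ast1 :: "'a \<Rightarrow> 'a \<Rightarrow> 'a" (infixl \<open>\<ast>\<^sub>1\<close> 70)
  where "x \<ast>\<^sub>1 y \<equiv> x \<searrow>\<^sub>1 y + x \<nearrow>\<^sub>1 y + x \<nwarrow>\<^sub>1 y + x \<swarrow>\<^sub>1 y"

abbreviation vee2 :: "'a \<Rightarrow> 'a \<Rightarrow> 'a" (infixl \<open>\<^bold>\<or>\<^sub>2\<close> 70)
  where "x \<^bold>\<or>\<^sub>2 y \<equiv> x \<searrow>\<^sub>2 y + x \<swarrow>\<^sub>2 y"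

abbreviation wedge2 :: "'a \<Rightarrow> 'a \<Rightarrow> 'a" (infixl \<open>\<^bold>\<and>\<^sub>2\<close> 70)
  where "x \<^bold>\<and>\<^sub>2 y \<equiv> x \<nearrow>\<^sub>2 y + x \<nwarrow>\<^sub>2 y"

abbreviation succ2 :: "'a \<Rightarrow> 'a \<Rightarrow> 'a" (infixl \<open>\<succ>\<^sub>2\<close> 70)
  where "x \<succ>\<^sub>2 y \<equiv> x \<searrow>\<^sub>2 y + x \<nearrow>\<^sub>2 y"

abbreviation prec2 :: "'a \<Rightarrow> 'a \<Rightarrow> 'a" (infixl \<open>\<prec>\<^sub>2\<close> 70)
  where "x \<prec>\<^sub>2 y \<equiv> x \<nwarrow>\<^sub>2 y + x \<swarrow>\<^sub>2 y"

abbreviation ast2 :: "'a \<Rightarrow> 'a \<Rightarrow> 'a" (infixl \<open>\<ast>\<^sub>2\<close> 70)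
  where "x \<ast>\<^sub>2 y \<equiv> x \<searrow>\<^sub>2 y + x \<nearrow>\<^sub>2 y + x \<nwarrow>\<^sub>2 y + x \<swarrow>\<^sub>2 y"

abbreviation se12 :: "'a \<Rightarrow> 'a \<Rightarrow> 'a" (infixl \<open>\<searrow>\<^sub>1\<^sub>2\<close> 70)
  where "x \<searrow>\<^sub>1\<^sub>2 y \<equiv> x \<searrow>\<^sub>1 y + x \<searrow>\<^sub>2 y"

abbreviation ne12 :: "'a \<Rightarrow> 'a \<Rightarrow> 'a" (infixl \<open>\<nearrow>\<^sub>1\<^sub>2\<close> 70)
  where "x \<nearrow>\<^sub>1\<^sub>2 y \<equiv> x \<nearrow>\<^sub>1 y + x \<nearrow>\<^sub>2 y"

abbreviation nw12 :: "'a \<Rightarrow> 'a \<Rightarrow> 'a" (infixl \<open>\<nwarrow>\<^sub>1\<^sub>2\<close> 70)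
  where "x \<nwarrow>\<^sub>1\<^sub>2 y \<equiv> x \<nwarrow>\<^sub>1 y + x \<nwarrow>\<^sub>2 y"

abbreviation sw12 :: "'a \<Rightarrow> 'a \<Rightarrow> 'a" (infixl \<open>\<swarrow>\<^sub>1\<^sub>2\<close> 70)
  where "x \<swarrow>\<^sub>1\<^sub>2 y \<equiv> x \<swarrow>\<^sub>1 y + x \<swarrow>\<^sub>2 y"

abbreviation vee12 :: "'a \<Rightarrow> 'a \<Rightarrow> 'a" (infixl \<open>\<^bold>\<or>\<^sub>1\<^sub>2\<close> 70)
  where "x \<^bold>\<or>\<^sub>1\<^sub>2 y \<equiv> x \<^bold>\<or>\<^sub>1 y + x \<^bold>\<or>\<^sub>2 y"

abbreviation wedge12 :: "'a \<Rightarrow> 'a \<Rightarrow> 'a" (infixl \<open>\<^bold>\<and>\<^sub>1\<^sub>2\<close> 70)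
  where "x \<^bold>\<and>\<^sub>1\<^sub>2 y \<equiv> x \<^bold>\<and>\<^sub>1 y + x \<^bold>\<and>\<^sub>2 y"

abbreviation succ12 :: "'a \<Rightarrow> 'a \<Rightarrow> 'a" (infixl \<open>\<succ>\<^sub>1\<^sub>2\<close> 70)
  where "x \<succ>\<^sub>1\<^sub>2 y \<equiv> x \<succ>\<^sub>1 y + x \<succ>\<^sub>2 y"

abbreviation prec12 :: "'a \<Rightarrow> 'a \<Rightarrow> 'a" (infixl \<open>\<prec>\<^sub>1\<^sub>2\<close> 70)
  where "x \<prec>\<^sub>1\<^sub>2 y \<equiv> x \<prec>\<^sub>1 y + x \<prec>\<^sub>2 y"

abbreviation ast12 :: "'a \<Rightarrow> 'a \<Rightarrow> 'a" (infixl \<open>\<ast>\<^sub>1\<^sub>2\<close> 70)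
  where "x \<ast>\<^sub>1\<^sub>2 y \<equiv> x \<ast>\<^sub>1 y + x \<ast>\<^sub>2 y"

end

(* The octo-algebra equations read "left side = right side = 0"; (a) and (b) are the two halves. *)
locale octo_algebra = fin_dim_space scale + eight_products se1 se2 ne1 ne2 nw1 nw2 sw1 sw2
  for scale :: "'k::field_char_0 \<Rightarrow> 'a::ab_group_add \<Rightarrow> 'a"
  and se1 :: "'a \<Rightarrow> 'a \<Rightarrow> 'a" (infixl \<open>\<searrow>\<^sub>1\<close> 70)
  and se2 :: "'a \<Rightarrow> 'a \<Rightarrow> 'a" (infixl \<open>\<searrow>\<^sub>2\<close> 70)
  and ne1 :: "'a \<Rightarrow> 'a \<Rightarrow> 'a" (infixl \<open>\<nearrow>\<^sub>1\<close> 70)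
  and ne2 :: "'a \<Rightarrow> 'a \<Rightarrow> 'a" (infixl \<open>\<nearrow>\<^sub>2\<close> 70)
  and nw1 :: "'a \<Rightarrow> 'a \<Rightarrow> 'a" (infixl \<open>\<nwarrow>\<^sub>1\<close> 70)
  and nw2 :: "'a \<Rightarrow> 'a \<Rightarrow> 'a" (infixl \<open>\<nwarrow>\<^sub>2\<close> 70)
  and sw1 :: "'a \<Rightarrow> 'a \<Rightarrow> 'a" (infixl \<open>\<swarrow>\<^sub>1\<close> 70)
  and sw2 :: "'a \<Rightarrow> 'a \<Rightarrow> 'a" (infixl \<open>\<swarrow>\<^sub>2\<close> 70) +
  assumes
    bilinear_se1: "bilinear_product scale (\<searrow>\<^sub>1)"
  and bilinear_se2: "bilinear_product scale (\<searrow>\<^sub>2)"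
  and bilinear_ne1: "bilinear_product scale (\<nearrow>\<^sub>1)"
  and bilinear_ne2: "bilinear_product scale (\<nearrow>\<^sub>2)"
  and bilinear_nw1: "bilinear_product scale (\<nwarrow>\<^sub>1)"
  and bilinear_nw2: "bilinear_product scale (\<nwarrow>\<^sub>2)"
  and bilinear_sw1: "bilinear_product scale (\<swarrow>\<^sub>1)"
  and bilinear_sw2: "bilinear_product scale (\<swarrow>\<^sub>2)"
  and A1a: "x \<searrow>\<^sub>2 (y \<searrow>\<^sub>2 z) - (x \<ast>\<^sub>1\<^sub>2 y) \<searrow>\<^sub>2 z = 0"
  and A1b: "y \<searrow>\<^sub>2 (x \<searrow>\<^sub>2 z) - (y \<ast>\<^sub>1\<^sub>2 x) \<searrow>\<^sub>2 z = 0"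
  and A2a: "x \<searrow>\<^sub>2 (y \<nearrow>\<^sub>2 z) - (x \<^bold>\<or>\<^sub>1\<^sub>2 y) \<nearrow>\<^sub>2 z = 0"
  and A2b: "y \<nearrow>\<^sub>2 (x \<succ>\<^sub>2 z) - (y \<^bold>\<and>\<^sub>1\<^sub>2 x) \<nearrow>\<^sub>2 z = 0"
  and A3a: "x \<searrow>\<^sub>2 (y \<nearrow>\<^sub>1 z) - (x \<^bold>\<or>\<^sub>2 y) \<nearrow>\<^sub>1 z = 0"
  and A3b: "y \<nearrow>\<^sub>1 (x \<succ>\<^sub>1\<^sub>2 z) - (y \<^bold>\<and>\<^sub>1 x) \<nearrow>\<^sub>1 z = 0"
  and A4a: "x \<nearrow>\<^sub>2 (y \<succ>\<^sub>1 z) - (x \<^bold>\<and>\<^sub>2 y) \<nearrow>\<^sub>1 z = 0"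
  and A4b: "y \<searrow>\<^sub>1 (x \<nearrow>\<^sub>1\<^sub>2 z) - (y \<^bold>\<or>\<^sub>1 x) \<nearrow>\<^sub>1 z = 0"
  and A5a: "x \<searrow>\<^sub>2 (y \<searrow>\<^sub>1 z) - (x \<ast>\<^sub>2 y) \<searrow>\<^sub>1 z = 0"
  and A5b: "y \<searrow>\<^sub>1 (x \<searrow>\<^sub>1\<^sub>2 z) - (y \<ast>\<^sub>1 x) \<searrow>\<^sub>1 z = 0"
  and A6a: "x \<searrow>\<^sub>2 (y \<nwarrow>\<^sub>1 z) - (x \<searrow>\<^sub>2 y) \<nwarrow>\<^sub>1 z = 0"
  and A6b: "y \<nwarrow>\<^sub>1 (x \<ast>\<^sub>1\<^sub>2 z) - (y \<nwarrow>\<^sub>1 x) \<nwarrow>\<^sub>1 z = 0"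
  and A7a: "x \<nearrow>\<^sub>2 (y \<prec>\<^sub>1 z) - (x \<nearrow>\<^sub>2 y) \<nwarrow>\<^sub>1 z = 0"
  and A7b: "y \<swarrow>\<^sub>1 (x \<^bold>\<and>\<^sub>1\<^sub>2 z) - (y \<swarrow>\<^sub>1 x) \<nwarrow>\<^sub>1 z = 0"
  and A8a: "x \<nearrow>\<^sub>1 (y \<prec>\<^sub>1\<^sub>2 z) - (x \<nearrow>\<^sub>1 y) \<nwarrow>\<^sub>1 z = 0"
  and A8b: "y \<swarrow>\<^sub>2 (x \<^bold>\<and>\<^sub>1 z) - (y \<swarrow>\<^sub>2 x) \<nwarrow>\<^sub>1 z = 0"
  and A9a: "x \<searrow>\<^sub>1 (y \<swarrow>\<^sub>1\<^sub>2 z) - (x \<succ>\<^sub>1 y) \<swarrow>\<^sub>1 z = 0"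
  and A9b: "y \<swarrow>\<^sub>2 (x \<^bold>\<or>\<^sub>1 z) - (y \<prec>\<^sub>2 x) \<swarrow>\<^sub>1 z = 0"
  and A10a: "x \<searrow>\<^sub>1 (y \<nwarrow>\<^sub>1\<^sub>2 z) - (x \<searrow>\<^sub>1 y) \<nwarrow>\<^sub>1 z = 0"
  and A10b: "y \<nwarrow>\<^sub>2 (x \<ast>\<^sub>1 z) - (y \<nwarrow>\<^sub>2 x) \<nwarrow>\<^sub>1 z = 0"
  and A11a: "x \<searrow>\<^sub>2 (y \<swarrow>\<^sub>1 z) - (x \<succ>\<^sub>2 y) \<swarrow>\<^sub>1 z = 0"
  and A11b: "y \<swarrow>\<^sub>1 (x \<^bold>\<or>\<^sub>1\<^sub>2 z) - (y \<prec>\<^sub>1 x) \<swarrow>\<^sub>1 z = 0"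
  and A12a: "x \<searrow>\<^sub>2 (y \<swarrow>\<^sub>2 z) - (x \<succ>\<^sub>1\<^sub>2 y) \<swarrow>\<^sub>2 z = 0"
  and A12b: "y \<swarrow>\<^sub>2 (x \<^bold>\<or>\<^sub>2 z) - (y \<prec>\<^sub>1\<^sub>2 x) \<swarrow>\<^sub>2 z = 0"
  and A13a: "x \<nearrow>\<^sub>2 (y \<prec>\<^sub>2 z) - (x \<nearrow>\<^sub>1\<^sub>2 y) \<nwarrow>\<^sub>2 z = 0"
  and A13b: "y \<swarrow>\<^sub>2 (x \<^bold>\<and>\<^sub>2 z) - (y \<swarrow>\<^sub>1\<^sub>2 x) \<nwarrow>\<^sub>2 z = 0"
  and A14a: "x \<searrow>\<^sub>2 (y \<nwarrow>\<^sub>2 z) - (x \<searrow>\<^sub>1\<^sub>2 y) \<nwarrow>\<^sub>2 z = 0"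
  and A14b: "y \<nwarrow>\<^sub>2 (x \<ast>\<^sub>2 z) - (y \<nwarrow>\<^sub>1\<^sub>2 x) \<nwarrow>\<^sub>2 z = 0"

end

theory Submission
  imports Defs
begin

text \<open>Expand an L-quadri-algebra equation in \<open>x, y, z\<close> by bilinearity and sort the monomials by their
  last letter. Those ending in \<open>z\<close> form one of the octo-algebra equations at \<open>(x, y, z)\<close>, those
  ending in \<open>y\<close> the negative of another one at \<open>(x, z, y)\<close>, and those ending in \<open>x\<close> a third one at
  \<open>(y, z, x)\<close>.\<close>

lemma bilinear_product_add:
  assumes "bilinear_product scale p"
  shows "p (x + y) z = p x z + p y z" "p x (y + z) = p x y + p x z"
  using assms unfolding bilinear_product_def linear_iff_module_hom module_hom_iff by blast+

text \<open>Additivity applied to \<open>(x - y) + y = x\<close>.\<close>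

lemma bilinear_product_diff:
  assumes "bilinear_product scale p"
  shows "p (x - y) z = p x z - p y z" "p x (y - z) = p x y - p x z"
  by (metis assms bilinear_product_add(1) diff_add_cancel add_diff_cancel)
    (metis assms bilinear_product_add(2) diff_add_cancel add_diff_cancel)

text \<open>Bilinearity is symmetric in the two arguments, so the opposite of \<open>q\<close>
  inherits it. All four new products have this shape.\<close>

lemma bilinear_product_sub_opposite:
  assumes "bilinear_product scale p" "bilinear_product scale q"
  shows "bilinear_product scale (\<lambda>x y. p x y - q y x)"
  using assms unfolding bilinear_product_def linear_iff_module_hom module_hom_iff
  by (simp add: module.scale_right_diff_distrib)

text \<open>Leaves only a formal identity between sums of monomials, which additivity settles. The
  signs are those of the last letters z, y, x.\<close>

lemma eq_from_three_eqs:
  fixes s t :: "'a::ab_group_add"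
  assumes "a = 0" "a' = 0" "b = 0" "b' = 0" "c = 0" "c' = 0"
    and "s - t = (a - a') - (b - b') + (c - c')"
  shows "s = t"
  using assms by simp

theorem proposition3p30:
  fixes scale :: "'k::field_char_0 \<Rightarrow> 'a::ab_group_add \<Rightarrow> 'a"
    and se1 :: "'a \<Rightarrow> 'a \<Rightarrow> 'a" (infixl \<open>\<searrow>\<^sub>1\<close> 70)
    and se2 :: "'a \<Rightarrow> 'a \<Rightarrow> 'a" (infixl \<open>\<searrow>\<^sub>2\<close> 70)
    and ne1 :: "'a \<Rightarrow> 'a \<Rightarrow> 'a" (infixl \<open>\<nearrow>\<^sub>1\<close> 70)
    and ne2 :: "'a \<Rightarrow> 'a \<Rightarrow> 'a" (infixl \<open>\<nearrow>\<^sub>2\<close> 70)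
    and nw1 :: "'a \<Rightarrow> 'a \<Rightarrow> 'a" (infixl \<open>\<nwarrow>\<^sub>1\<close> 70)
    and nw2 :: "'a \<Rightarrow> 'a \<Rightarrow> 'a" (infixl \<open>\<nwarrow>\<^sub>2\<close> 70)
    and sw1 :: "'a \<Rightarrow> 'a \<Rightarrow> 'a" (infixl \<open>\<swarrow>\<^sub>1\<close> 70)
    and sw2 :: "'a \<Rightarrow> 'a \<Rightarrow> 'a" (infixl \<open>\<swarrow>\<^sub>2\<close> 70)
  assumes "octo_algebra scale (\<searrow>\<^sub>1) (\<searrow>\<^sub>2) (\<nearrow>\<^sub>1) (\<nearrow>\<^sub>2) (\<nwarrow>\<^sub>1) (\<nwarrow>\<^sub>2) (\<swarrow>\<^sub>1) (\<swarrow>\<^sub>2)"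
  shows "L_quadri_algebra scale
    (\<lambda>x y. x \<searrow>\<^sub>2 y - y \<nwarrow>\<^sub>1 x)
    (\<lambda>x y. x \<nearrow>\<^sub>2 y - y \<swarrow>\<^sub>1 x)
    (\<lambda>x y. x \<nearrow>\<^sub>1 y - y \<swarrow>\<^sub>2 x)
    (\<lambda>x y. x \<searrow>\<^sub>1 y - y \<nwarrow>\<^sub>2 x)"
proof -
  interpret octo_algebra scale "(\<searrow>\<^sub>1)" "(\<searrow>\<^sub>2)" "(\<nearrow>\<^sub>1)" "(\<nearrow>\<^sub>2)" "(\<nwarrow>\<^sub>1)" "(\<nwarrow>\<^sub>2)" "(\<swarrow>\<^sub>1)" "(\<swarrow>\<^sub>2)"
    by (fact assms)
  note bilinear = bilinear_se1 bilinear_se2 bilinear_ne1 bilinear_ne2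
    bilinear_nw1 bilinear_nw2 bilinear_sw1 bilinear_sw2
  note expand = bilinear[THEN bilinear_product_add(1)] bilinear[THEN bilinear_product_add(2)]
    bilinear[THEN bilinear_product_diff(1)] bilinear[THEN bilinear_product_diff(2)] algebra_simps
  show ?thesis
    apply (intro L_quadri_algebra.intro L_quadri_algebra_axioms.intro fin_dim_space_axioms
        bilinear_product_sub_opposite bilinear)
    \<comment> \<open>Swapping \<open>x\<close> and \<open>y\<close> exchanges the two sides, and
      the monomials ending in \<open>y\<close> with those ending in \<open>x\<close>; hence
      \<open>A6a\<close> and \<open>A6b\<close> serve twice.\<close>
    subgoal for x y z
      by (rule eq_from_three_eqs[OF A1a[where x=x and y=y and z=z] A1b[where x=x and y=y and z=z]
            A6a[where x=x and y=z and z=y] A6b[where x=x and y=z and z=y]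
            A6a[where x=y and y=z and z=x] A6b[where x=y and y=z and z=x]])
        (simp add: expand)
    \<comment> \<open>Leading terms select the equations: the left side contains
      \<open>x \<searrow>\<^sub>2 (y \<nearrow>\<^sub>2 z)\<close> from \<open>A2a\<close> and
      \<open>- x \<searrow>\<^sub>2 (z \<swarrow>\<^sub>1 y)\<close> from \<open>A11a\<close>, the
      right side \<open>- y \<nearrow>\<^sub>2 (z \<prec>\<^sub>1 x)\<close> from
      \<open>A7a\<close>.\<close>
    subgoal for x y z
      by (rule eq_from_three_eqs[OF A2a[where x=x and y=y and z=z] A2b[where x=x and y=y and z=z]
            A11a[where x=x and y=z and z=y] A11b[where x=x and y=z and z=y]
            A7a[where x=y and y=z and z=x] A7b[where x=y and y=z and z=x]])
        (simp add: expand)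
    subgoal for x y z
      by (rule eq_from_three_eqs[OF A3a[where x=x and y=y and z=z] A3b[where x=x and y=y and z=z]
            A12a[where x=x and y=z and z=y] A12b[where x=x and y=z and z=y]
            A8a[where x=y and y=z and z=x] A8b[where x=y and y=z and z=x]])
        (simp add: expand)
    \<comment> \<open>The inner sums become \<open>y \<succ>\<^sub>1 z - z \<prec>\<^sub>2 y\<close>
      on the left and \<open>x \<nearrow>\<^sub>1\<^sub>2 z - z \<swarrow>\<^sub>1\<^sub>2 x\<close>
      on the right, which leads to \<open>A4a\<close>, \<open>A13a\<close> and
      \<open>A9a\<close>.\<close>
    subgoal for x y z
      by (rule eq_from_three_eqs[OF A4a[where x=x and y=y and z=z] A4b[where x=x and y=y and z=z]
            A13a[where x=x and y=z and z=y] A13b[where x=x and y=z and z=y]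
            A9a[where x=y and y=z and z=x] A9b[where x=y and y=z and z=x]])
        (simp add: expand)
    subgoal for x y z
      by (rule eq_from_three_eqs[OF A5a[where x=x and y=y and z=z] A5b[where x=x and y=y and z=z]
            A14a[where x=x and y=z and z=y] A14b[where x=x and y=z and z=y]
            A10a[where x=y and y=z and z=x] A10b[where x=y and y=z and z=x]])
        (simp add: expand)
    done
qed

end
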